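(* The monic sequence $\{P_n^{[2]}(x)\}_{n\ge 0}$ orthogonal with respect to $(x-c)^2d\mu$ satisfies the three term recurrence relation $$x\,P_n^{[2]}(x)=P_{n+1}^{[2]}(x)+\kappa_nP_n^{[2]}(x)+\tau_nP_{n-1}^{[2]}(x),\qquad n\ge 0,$$ with $P_{-1}^{[2]}(x)=0$, $P_0^{[2]}(x)=1$, and $$\kappa_n=\left(\beta_n+\gamma_n\frac{d_{n-1}}{e_{n-1}}\right)e_n\left(\frac{r_n^{[2]}}{r_n}\right)^2-d_n\left(\frac{r_n^{[2]}}{r_{n+1}}\right)^2,\qquad \tau_n=\left(\frac{r_{n-1}^{[2]}}{r_{n+1}}\right)^2\frac{K_{n+1}(c,c)}{K_n(c,c)}>0,$$ where $d_n$ and $e_n$ (defined in the context through values of $P_n,P_{n+1},P_{n+2}$ and their derivatives at $c$) also satisfy $$d_n=\frac{r_{n+1}}{r_{n+2}}\frac{p_{n+2}(c)}{p_{n+1}(c)}+\frac{r_n}{r_{n+1}}\frac{p_n(c)}{p_{n+1}(c)}\frac{K_{n+1}(c,c)}{K_n(c,c)},\qquad e_n=\left(\frac{r_n}{r_{n+1}}\right)^2\frac{K_{n+1}(c,c)}{K_n(c,c)}>0.$$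
   Context: $\mu$ is a positive Borel measure with infinite support contained in an interval $E\subseteq\mathbb{R}$ (bounded or unbounded), with all moments finite, and $c\in\mathbb{R}\setminus E$. $\{P_n\}_{n\ge0}$ are the monic orthogonal polynomials for $\langle f,g\rangle_\mu=\int_E fg\,d\mu$, with $xP_n=P_{n+1}+\beta_nP_n+\gamma_nP_{n-1}$ ($n\ge0$, $P_{-1}=0$). $p_n(x)=r_nx^n+\cdots$ with $r_n>0$ are the corresponding orthonormal polynomials, and $K_n(x,y)=\sum_{k=0}^np_k(x)p_k(y)$. $\{P_n^{[2]}\}_{n\ge0}$ are the monic orthogonal polynomials with respect to $\int_E f(x)g(x)(x-c)^2d\mu(x)$, and $p_n^{[2]}(x)=r_n^{[2]}x^n+\cdots$, $r_n^{[2]}>0$, the corresponding orthonormal ones. For $n\ge 0$, $$d_n=\frac{P_{n+2}(c)P_n'(c)-P_{n+2}'(c)P_n(c)}{P_{n+1}(c)P_n'(c)-P_{n+1}'(c)P_n(c)},\qquad e_n=\frac{P_{n+2}(c)P_{n+1}'(c)-P_{n+2}'(c)P_{n+1}(c)}{P_{n+1}(c)P_n'(c)-P_{n+1}'(c)P_n(c)}.$$ For $n=0$ the term $\gamma_0 d_{-1}/e_{-1}$ is read as $0$, and the formula for $\tau_n$ is for $n\ge1$ (the value of $\tau_0$ is irrelevant since $P_{-1}^{[2]}=0$). *)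

theory Defs
  imports "HOL-Analysis.Analysis" "HOL-Computational_Algebra.Polynomial"
begin

definition measure_support :: "'a::topological_space measure \<Rightarrow> 'a set" where
  "measure_support M = {x. \<forall>U. open U \<longrightarrow> x \<in> U \<longrightarrow> emeasure M U > 0}"

definition ip :: "real measure \<Rightarrow> real set \<Rightarrow> real poly \<Rightarrow> real poly \<Rightarrow> real" where
  "ip M E f g = (LINT x:E|M. poly f x * poly g x)"

definition ip2 :: "real measure \<Rightarrow> real set \<Rightarrow> real \<Rightarrow> real poly \<Rightarrow> real poly \<Rightarrow> real" where
  "ip2 M E c f g = (LINT x:E|M. poly f x * poly g x * (x - c)^2)"

definition monic_orthogonal ::
  "(real poly \<Rightarrow> real poly \<Rightarrow> real) \<Rightarrow> (nat \<Rightarrow> real poly) \<Rightarrow> bool" where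
  "monic_orthogonal B P \<longleftrightarrow>
     (\<forall>n. degree (P n) = n \<and> lead_coeff (P n) = 1) \<and>
     (\<forall>m n. m \<noteq> n \<longrightarrow> B (P m) (P n) = 0)"

definition orthonormal_seq ::
  "(real poly \<Rightarrow> real poly \<Rightarrow> real) \<Rightarrow> (nat \<Rightarrow> real poly) \<Rightarrow> bool" where
  "orthonormal_seq B p \<longleftrightarrow>
     (\<forall>n. degree (p n) = n \<and> lead_coeff (p n) > 0) \<and>
     (\<forall>m n. B (p m) (p n) = (if m = n then 1 else 0))"

text \<open>The term of index \<open>n - 1\<close>, with the convention that the term of index \<open>-1\<close> is the zero
  polynomial.\<close>

definition prev :: "(nat \<Rightarrow> real poly) \<Rightarrow> nat \<Rightarrow> real poly" where
  "prev P n = (case n of 0 \<Rightarrow> 0 | Suc m \<Rightarrow> P m)"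

definition cd_kernel :: "(nat \<Rightarrow> real poly) \<Rightarrow> nat \<Rightarrow> real \<Rightarrow> real \<Rightarrow> real" where
  "cd_kernel p n x y = (\<Sum>k\<le>n. poly (p k) x * poly (p k) y)"

definition wronsk :: "(nat \<Rightarrow> real poly) \<Rightarrow> real \<Rightarrow> nat \<Rightarrow> nat \<Rightarrow> real" where
  "wronsk P c i j =
     poly (P i) c * poly (pderiv (P j)) c - poly (pderiv (P i)) c * poly (P j) c"

definition d_coeff :: "(nat \<Rightarrow> real poly) \<Rightarrow> real \<Rightarrow> nat \<Rightarrow> real" where
  "d_coeff P c n = wronsk P c (n + 2) n / wronsk P c (n + 1) n"

definition e_coeff :: "(nat \<Rightarrow> real poly) \<Rightarrow> real \<Rightarrow> nat \<Rightarrow> real" where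
  "e_coeff P c n = wronsk P c (n + 2) (n + 1) / wronsk P c (n + 1) n"

end

theory Submission
  imports Defs
begin

text \<open>Put \<open>h\<^sub>n = 1 / r\<^sub>n\<^sup>2 = \<langle>P\<^sub>n, P\<^sub>n\<rangle>\<close>. The three term recurrence gives the confluent Christoffel-Darboux
  formula \<open>W(P\<^sub>n\<^sub>+\<^sub>1, P\<^sub>n)(c) = - h\<^sub>n K\<^sub>n(c,c)\<close>, so \<open>d\<^sub>n\<close> and \<open>e\<^sub>n\<close> solve the linear system saying that
  \<open>P\<^sub>n\<^sub>+\<^sub>2 - d\<^sub>n P\<^sub>n\<^sub>+\<^sub>1 + e\<^sub>n P\<^sub>n\<close> has a double zero at \<open>c\<close>. The quotient by \<open>(x - c)\<^sup>2\<close> is monic of degree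
  \<open>n\<close> and orthogonal to lower degrees for \<open>(x - c)\<^sup>2 d\<mu>\<close>, hence equals \<open>P\<^sub>n\<^sup>[\<^sup>2\<^sup>]\<close>. Pairing this
  identity with suitable polynomials yields all coefficients. If \<open>p\<^sub>n\<^sub>+\<^sub>1 = (x - c) q\<close>, then
  \<open>(x - c) q\<^sup>2\<close> has integral \<open>0\<close> and constant sign on \<open>E\<close>, hence vanishes almost everywhere, which
  contradicts \<open>\<langle>p\<^sub>n\<^sub>+\<^sub>1, p\<^sub>n\<^sub>+\<^sub>1\<rangle> = 1\<close>.\<close>

section \<open>Orthogonal polynomials of an abstract linear functional\<close>

locale moment_functional =
  fixes L :: "real poly \<Rightarrow> real" and p P :: "nat \<Rightarrow> real poly"
  assumes L_add: "L (f + g) = L f + L g"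
    and L_smult: "L (smult a f) = a * L f"
    and orthonormal: "orthonormal_seq (\<lambda>f g. L (f * g)) p"
    and monic: "monic_orthogonal (\<lambda>f g. L (f * g)) P"
begin

abbreviation r :: "nat \<Rightarrow> real" where "r n \<equiv> lead_coeff (p n)"

lemma L_0 [simp]: "L 0 = 0"
  using L_smult[of 0 0] by simp

lemma L_diff: "L (f - g) = L f - L g"
  using L_add[of "f - g" g] by simp

lemma degree_p [simp]: "degree (p n) = n"
  and r_pos [simp]: "coeff (p n) n > 0"
  and L_p_p: "L (p m * p n) = (if m = n then 1 else 0)"
proof -
  show deg: "degree (p n) = n" for n
    using orthonormal by (simp add: orthonormal_seq_def)
  show "coeff (p n) n > 0"
    using orthonormal deg[of n] unfolding orthonormal_seq_def by metis
  show "L (p m * p n) = (if m = n then 1 else 0)"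
    using orthonormal by (simp add: orthonormal_seq_def)
qed

lemma r_nonzero [simp]: "coeff (p n) n \<noteq> 0"
  using r_pos[of n] by linarith

lemma degree_P [simp]: "degree (P n) = n"
  and lead_coeff_P [simp]: "coeff (P n) n = 1"
  and L_P_P: "m \<noteq> n \<Longrightarrow> L (P m * P n) = 0"
proof -
  show deg: "degree (P n) = n" for n
    using monic by (simp add: monic_orthogonal_def)
  show "coeff (P n) n = 1"
    using monic deg[of n] unfolding monic_orthogonal_def by metis
  show "m \<noteq> n \<Longrightarrow> L (P m * P n) = 0"
    using monic by (simp add: monic_orthogonal_def)
qed

text \<open>Leading terms of \<open>f\<close> are removed one by one with multiples of
  \<open>q n\<close>. The family \<open>q\<close> stays arbitrary because both \<open>p\<close> and
  \<open>P\<close> serve as expansion basis; bounding coefficients instead of the degree makes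
  \<open>n = 0\<close> mean \<open>f = 0\<close>.\<close>

lemma L_mult_eq_0:
  assumes "\<And>k. degree (q k) = k" "\<And>k. coeff (q k) k \<noteq> 0"
    and "\<And>k. k < n \<Longrightarrow> L (w * q k) = 0"
    and "\<And>k. n \<le> k \<Longrightarrow> coeff f k = 0"
  shows "L (w * f) = 0"
  using assms(3,4)
proof (induction n arbitrary: f)
  case 0
  then have "f = 0" by (intro poly_eqI) simp
  then show ?case by simp
next
  case (Suc n)
  define g where "g = f - smult (coeff f n / coeff (q n) n) (q n)"
  have "coeff g k = 0" if "n \<le> k" for k
  proof (cases "k = n")
    case True
    then show ?thesis using assms(2)[of n] by (simp add: g_def)
  next
    case False
    then have "coeff (q n) k = 0" using that assms(1)[of n] by (intro coeff_eq_0) simp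
    then show ?thesis using Suc.prems(2)[of k] False that by (simp add: g_def)
  qed
  with Suc have "L (w * g) = 0" by simp
  then show ?case using Suc.prems(1)[of n] by (simp add: g_def algebra_simps L_diff L_smult)
qed

text \<open>Subtracting the right multiple of \<open>p n\<close> leaves a remainder of lower degree,
  to which \<open>p n\<close> is orthogonal. Nearly all pairings below are evaluated this way,
  through \<open>L_P_mult\<close>.\<close>

lemma L_p_mult:
  assumes "\<And>k. n < k \<Longrightarrow> coeff f k = 0"
  shows "L (p n * f) = coeff f n / r n"
proof -
  define g where "g = f - smult (coeff f n / r n) (p n)"
  have "L (p n * g) = 0"
  proof (rule L_mult_eq_0[of p n])
    fix k assume "n \<le> k"
    then show "coeff g k = 0"
      using assms[of k] by (cases "k = n") (simp_all add: g_def coeff_eq_0)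
  qed (simp_all add: L_p_p)
  then show ?thesis by (simp add: g_def algebra_simps L_diff L_smult L_p_p)
qed

text \<open>Replaces definiteness, since \<open>L\<close> is not assumed positive: pairing with
  \<open>p n\<close> exposes the top coefficient, so the bound descends to zero.\<close>

lemma eq_0I:
  assumes "\<And>k. n \<le> k \<Longrightarrow> coeff f k = 0" and "\<And>k. k < n \<Longrightarrow> L (p k * f) = 0"
  shows "f = 0"
  using assms
proof (induction n)
  case 0
  then show ?case by (intro poly_eqI) simp
next
  case (Suc n)
  have "L (p n * f) = coeff f n / r n"
    using Suc.prems(1) by (intro L_p_mult) simp
  then have "coeff f n = 0" using Suc.prems(2)[of n] by simp
  then show ?case using Suc by (metis le_antisym less_Suc_eq not_less_eq_eq)
qed

text \<open>The leading terms of \<open>smult (r n) Q\<close> and \<open>p n\<close> cancel, which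
  puts their difference within reach of \<open>eq_0I\<close>.\<close>

lemma smult_eq_p:
  assumes "\<And>k. n < k \<Longrightarrow> coeff Q k = 0" "coeff Q n = 1"
    and "\<And>k. k < n \<Longrightarrow> L (p k * Q) = 0"
  shows "smult (r n) Q = p n"
proof -
  have "smult (r n) Q - p n = 0"
  proof (rule eq_0I[of n])
    fix k assume "n \<le> k"
    then show "coeff (smult (r n) Q - p n) k = 0"
      using assms(1)[of k] assms(2) by (cases "k = n") (simp_all add: coeff_eq_0)
  next
    fix k assume "k < n"
    then show "L (p k * (smult (r n) Q - p n)) = 0"
      using assms(3)[of k] by (simp add: algebra_simps L_diff L_smult L_p_p)
  qed
  then show ?thesis by simp
qed

lemma p_eq_smult_P: "p n = smult (r n) (P n)"
proof (rule smult_eq_p[symmetric])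
  fix k assume "k < n"
  then have "L (P n * p k) = 0"
    by - (rule L_mult_eq_0[of P n], simp_all add: coeff_eq_0 L_P_P)
  then show "L (p k * P n) = 0" by (simp add: mult.commute)
qed (simp_all add: coeff_eq_0)

lemma L_p_mult_eq: "L (p n * f) = r n * L (P n * f)"
  by (subst p_eq_smult_P) (simp add: L_smult)

lemma poly_p: "poly (p n) x = r n * poly (P n) x"
  by (subst p_eq_smult_P) simp

lemma monic_unique:
  assumes "\<And>k. n < k \<Longrightarrow> coeff Q k = 0" "coeff Q n = 1"
    and "\<And>k. k < n \<Longrightarrow> L (P k * Q) = 0"
  shows "Q = P n"
proof -
  have "smult (r n) Q = p n"
    using assms by (intro smult_eq_p) (auto simp: L_p_mult_eq)
  then have "smult (r n) Q = smult (r n) (P n)" using p_eq_smult_P[of n] by simp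
  then show ?thesis by (metis r_nonzero degree_p smult_cancel)
qed

lemma L_P_mult:
  assumes "\<And>k. n < k \<Longrightarrow> coeff f k = 0"
  shows "L (P n * f) = coeff f n / (r n)\<^sup>2"
proof -
  have "r n * L (P n * f) = coeff f n / r n"
    using L_p_mult[OF assms] by (simp add: L_p_mult_eq)
  then show ?thesis by (simp add: power2_eq_square field_simps)
qed

lemma L_P_sq: "L (P n * P n) = 1 / (r n)\<^sup>2"
  by (subst L_P_mult) (simp_all add: coeff_eq_0)

lemma P_0 [simp]: "P 0 = 1"
  using lead_coeff_P[of 0] degree_P[of 0] by (metis degree_eq_zeroE coeff_pCons_0 one_pCons)


lemma coeff_X_mult: "coeff ([:0, 1:] * f) k = (case k of 0 \<Rightarrow> 0 | Suc m \<Rightarrow> coeff f m)"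
  for f :: "real poly"
  by (simp add: coeff_pCons split: nat.splits)

text \<open>Multiplication by \<open>x\<close> is symmetric for the pairing, so it moves to
  \<open>P k\<close>, where the degree stays at most \<open>n\<close>.\<close>

lemma L_P_X_P:
  assumes "k < n"
  shows "L (P k * ([:0, 1:] * P n)) = (if n = Suc k then 1 / (r n)\<^sup>2 else 0)"
proof -
  have "L (P n * ([:0, 1:] * P k)) = coeff ([:0, 1:] * P k) n / (r n)\<^sup>2"
    using assms by (intro L_P_mult) (auto simp: coeff_X_mult coeff_eq_0 split: nat.splits)
  also have "coeff ([:0, 1:] * P k) n = (if n = Suc k then 1 else 0)"
    using assms by (auto simp: coeff_X_mult coeff_eq_0 split: nat.splits)
  finally show ?thesis by (simp add: mult_ac)
qed

text \<open>Explicit coefficients matter here: this is later applied to the weighted functional. At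
  \<open>n = 0\<close> the truncated index \<open>n - 1\<close> is harmless, as
  \<open>prev P 0 = 0\<close>.\<close>

lemma three_term:
  "[:0, 1:] * P n = P (n + 1) + smult ((r n)\<^sup>2 * L (P n * ([:0, 1:] * P n))) (P n)
     + smult ((r (n - 1) / r n)\<^sup>2) (prev P n)"
proof -
  define \<kappa> where "\<kappa> = (r n)\<^sup>2 * L (P n * ([:0, 1:] * P n))"
  define \<tau> where "\<tau> = (r (n - 1) / r n)\<^sup>2"
  define R where "R = [:0, 1:] * P n - smult \<kappa> (P n) - smult \<tau> (prev P n)"
  have "R = P (Suc n)"
  proof (rule monic_unique)
    fix k assume "Suc n < k"
    then show "coeff R k = 0"
      by (auto simp: R_def coeff_X_mult coeff_eq_0 prev_def split: nat.splits)
  next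
    show "coeff R (Suc n) = 1"
      by (auto simp: R_def coeff_X_mult coeff_eq_0 prev_def split: nat.splits)
  next
    fix k assume k: "k < Suc n"
    have *: "L (P k * R) = L (P k * ([:0, 1:] * P n)) - \<kappa> * L (P k * P n) - \<tau> * L (P k * prev P n)"
      unfolding R_def right_diff_distrib mult_smult_right L_diff L_smult ..
    show "L (P k * R) = 0"
    proof (cases "k = n")
      case True
      have "L (P n * prev P n) = 0"
        by (auto simp: prev_def L_P_P split: nat.splits)
      then show ?thesis using True unfolding * by (simp add: L_P_sq \<kappa>_def)
    next
      case False
      with k obtain m where m: "n = Suc m" "k \<le> m"
        by (metis less_Suc_eq less_Suc_eq_le not0_implies_Suc not_less0)
      then show ?thesis
        unfolding * using L_P_X_P[of k n]
        by (cases "k = m") (auto simp: L_P_P L_P_sq prev_def \<tau>_def power_divide)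
    qed
  qed
  then show ?thesis
    unfolding \<kappa>_def[symmetric] \<tau>_def[symmetric] by (simp only: R_def diff_eq_eq Suc_eq_plus1 add_ac)
qed

end

section \<open>Wronskians at a point and the confluent Christoffel-Darboux formula\<close>

locale recurrent_moment_functional = moment_functional +
  fixes \<beta> \<gamma> :: "nat \<Rightarrow> real"
  assumes rec: "[:0, 1:] * P n = P (n + 1) + smult (\<beta> n) (P n) + smult (\<gamma> n) (prev P n)"
begin

lemma L_P_X_P_eq:
  "L (P k * ([:0, 1:] * P n))
     = L (P k * P (n + 1)) + \<beta> n * L (P k * P n) + \<gamma> n * L (P k * prev P n)"
  unfolding rec distrib_left mult_smult_right L_add L_smult ..

text \<open>Obtained by pairing the recurrence with \<open>P n\<close>. Only successor indices
  occur, because \<open>\<gamma> 0\<close> multiplies the zero polynomial.\<close>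

lemma \<gamma>_Suc: "\<gamma> (Suc n) = (r n / r (Suc n))\<^sup>2"
proof -
  have "\<gamma> (Suc n) / (r n)\<^sup>2 = 1 / (r (Suc n))\<^sup>2"
    using L_P_X_P_eq[of n "Suc n"] L_P_X_P[of n "Suc n"]
    by (simp add: L_P_P L_P_sq prev_def)
  then show ?thesis by (simp add: power_divide field_simps)
qed

text \<open>After eliminating the top polynomial by the recurrence, the terms with \<open>c\<close>
  and \<beta> cancel by antisymmetry; the square comes from differentiating the factor
  \<open>x\<close>.\<close>

lemma wronsk_Suc:
  "wronsk P c (Suc (Suc n)) (Suc n) = \<gamma> (Suc n) * wronsk P c (Suc n) n - (poly (P (Suc n)) c)\<^sup>2"
proof -
  have *: "P (Suc (Suc n)) = [:0, 1:] * P (Suc n) - smult (\<beta> (Suc n)) (P (Suc n)) - smult (\<gamma> (Suc n)) (P n)"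
    using rec[of "Suc n"] by (simp add: prev_def algebra_simps)
  show ?thesis
    unfolding wronsk_def *
    by (simp add: pderiv_add pderiv_diff pderiv_mult pderiv_smult pderiv_pCons algebra_simps power2_eq_square)
qed

lemma wronsk_eq: "wronsk P c (Suc n) n = - cd_kernel p n c c / (r n)\<^sup>2"
proof (induction n)
  case 0
  have "poly (pderiv (P (Suc 0))) c = 1"
    using degree_P[of "Suc 0"] lead_coeff_P[of "Suc 0"]
    by (simp add: poly_altdef degree_pderiv coeff_pderiv)
  then show ?case
    by (simp add: wronsk_def cd_kernel_def poly_p power2_eq_square)
next
  case (Suc n)
  have "cd_kernel p (Suc n) c c = cd_kernel p n c c + (r (Suc n) * poly (P (Suc n)) c)\<^sup>2"
    by (simp add: cd_kernel_def poly_p power2_eq_square)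
  then show ?case
    unfolding wronsk_Suc Suc \<gamma>_Suc by (simp add: power_divide field_simps)
qed

lemma cd_kernel_pos: "cd_kernel p n c c > 0"
proof -
  have "0 < poly (p 0) c * poly (p 0) c"
    by (simp add: poly_p)
  also have "\<dots> \<le> cd_kernel p n c c"
    unfolding cd_kernel_def by (rule member_le_sum) auto
  finally show ?thesis .
qed

lemma e_coeff_eq:
  "e_coeff P c n = (r n / r (n + 1))\<^sup>2 * (cd_kernel p (n + 1) c c / cd_kernel p n c c)"
  using cd_kernel_pos[of n c]
  by (simp add: e_coeff_def wronsk_eq power_divide field_simps)

lemma e_coeff_pos: "e_coeff P c n > 0"
  using cd_kernel_pos[of n c] cd_kernel_pos[of "n + 1" c]
  unfolding e_coeff_eq by simp

text \<open>Cramer's rule: the two conditions are linear in the two coefficients, with determinant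
  the Wronskian, which is nonzero because the kernel is positive.\<close>

lemma double_zero:
  fixes c n
  defines "Q \<equiv> P (n + 2) - smult (d_coeff P c n) (P (n + 1)) + smult (e_coeff P c n) (P n)"
  shows "poly Q c = 0" and "poly (pderiv Q) c = 0"
proof -
  have "wronsk P c (n + 1) n \<noteq> 0"
    using cd_kernel_pos[of n c] by (simp add: wronsk_eq)
  then show "poly Q c = 0" and "poly (pderiv Q) c = 0"
    unfolding Q_def d_coeff_def e_coeff_def
    by (simp_all add: pderiv_diff pderiv_add pderiv_smult field_simps)
      (simp_all add: wronsk_def algebra_simps)
qed

text \<open>This is the vanishing of \<open>Q\<close> at \<open>c\<close> divided by
  \<open>P (n + 1)\<close> at \<open>c\<close>, rewritten in orthonormal values.\<close>

lemma d_coeff_eq: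
  assumes "poly (p (n + 1)) c \<noteq> 0"
  shows "d_coeff P c n = r (n + 1) / r (n + 2) * (poly (p (n + 2)) c / poly (p (n + 1)) c)
    + r n / r (n + 1) * (poly (p n) c / poly (p (n + 1)) c) * (cd_kernel p (n + 1) c c / cd_kernel p n c c)"
proof -
  have 1: "r (n + 1) / r (n + 2) * (poly (p (n + 2)) c / poly (p (n + 1)) c)
      = poly (P (n + 2)) c / poly (P (n + 1)) c"
    unfolding poly_p by simp
  have 2: "r n / r (n + 1) * (poly (p n) c / poly (p (n + 1)) c) * (cd_kernel p (n + 1) c c / cd_kernel p n c c)
      = e_coeff P c n * poly (P n) c / poly (P (n + 1)) c"
    unfolding poly_p e_coeff_eq by (simp add: power2_eq_square mult_ac)
  have "poly (P (n + 1)) c \<noteq> 0"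
    using assms unfolding poly_p by simp
  then show ?thesis
    unfolding 1 2 using double_zero(1)[of n c] by (simp add: field_simps)
qed

end

section \<open>The Christoffel transform with weight \<open>(x - c)^2\<close>\<close>

locale double_christoffel =
  recurrent_moment_functional L p P \<beta> \<gamma> +
  T: moment_functional "\<lambda>f. L (f * [:- c, 1:]\<^sup>2)" p2 P2
  for L p P \<beta> \<gamma> c p2 P2
begin

abbreviation d where "d \<equiv> d_coeff P c"
abbreviation e where "e \<equiv> e_coeff P c"

lemma christoffel: "[:- c, 1:]\<^sup>2 * P2 n = P (n + 2) - smult (d n) (P (n + 1)) + smult (e n) (P n)"
proof -
  define Q where "Q = P (n + 2) - smult (d n) (P (n + 1)) + smult (e n) (P n)"
  from double_zero(1)[of n c] obtain S where S: "Q = [:- c, 1:] * S"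
    unfolding Q_def poly_eq_0_iff_dvd dvd_def by blast
  \<comment> \<open>The derivative of \<open>(x - c) * S\<close> at \<open>c\<close> is the value of
    \<open>S\<close> there, so a second linear factor splits off.\<close>
  from double_zero(2)[of n c] have "poly S c = 0"
    unfolding Q_def[symmetric] S by (simp add: pderiv_diff pderiv_smult pderiv_pCons)
  then obtain R where R: "S = [:- c, 1:] * R"
    unfolding poly_eq_0_iff_dvd dvd_def by blast
  have QR: "Q = [:- c, 1:]\<^sup>2 * R"
    unfolding S R power2_eq_square mult.assoc ..
  have degQ: "degree Q \<le> n + 2"
    unfolding Q_def by (intro degree_add_le degree_diff_le) auto
  have lcQ: "coeff Q (n + 2) = 1"
    by (simp add: Q_def coeff_eq_0)
  then have "degree Q = n + 2"
    using degQ by (metis le_antisym le_degree zero_neq_one)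
  moreover have "R \<noteq> 0"
    using lcQ unfolding QR by auto
  then have "degree Q = 2 + degree R"
    unfolding QR by (subst degree_mult_eq) (auto simp: degree_power_eq)
  ultimately have degR: "degree R = n" by simp
  have lcR: "coeff R n = 1"
    using lcQ \<open>degree Q = n + 2\<close> degR
    by (metis QR lead_coeff_mult lead_coeff_power lead_coeff_pCons(1) mult_1 one_neq_zero
        one_pCons pCons_eq_0_iff power_one lead_coeff_1)
  have "R = P2 n"
  proof (rule T.monic_unique)
    fix k assume k: "k < n"
    \<comment> \<open>Needed for \<open>m\<close> equal to \<open>n\<close>, \<open>n + 1\<close>
      and \<open>n + 2\<close>, all above \<open>k\<close>.\<close>
    have *: "L (P m * P2 k) = 0" if "k < m" for m
      using that by (subst L_P_mult) (auto simp: coeff_eq_0)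
    have "P2 k * R * [:- c, 1:]\<^sup>2
        = P (n + 2) * P2 k - smult (d n) (P (n + 1) * P2 k) + smult (e n) (P n * P2 k)"
    proof -
      have "P2 k * R * [:- c, 1:]\<^sup>2 = Q * P2 k" unfolding QR by (simp only: mult_ac)
      also have "\<dots> = P (n + 2) * P2 k - smult (d n) (P (n + 1) * P2 k) + smult (e n) (P n * P2 k)"
        unfolding Q_def by (simp add: algebra_simps)
      finally show ?thesis .
    qed
    then show "L (P2 k * R * [:- c, 1:]\<^sup>2) = 0"
      using k by (simp add: L_add L_diff L_smult *)
  qed (use degR lcR in \<open>auto simp: coeff_eq_0\<close>)
  then show ?thesis using QR Q_def by simp
qed

text \<open>Turns weighted pairings with \<open>P2 n\<close> into unweighted ones; the choice of
  \<open>f\<close> then yields each coefficient.\<close>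

lemma L_christoffel:
  "L (P2 n * f * [:- c, 1:]\<^sup>2) = L (P (n + 2) * f) - d n * L (P (n + 1) * f) + e n * L (P n * f)"
proof -
  have "P2 n * f * [:- c, 1:]\<^sup>2 = ([:- c, 1:]\<^sup>2 * P2 n) * f" by (simp only: mult_ac)
  also have "\<dots> = P (n + 2) * f - smult (d n) (P (n + 1) * f) + smult (e n) (P n * f)"
    unfolding christoffel by (simp add: algebra_simps)
  finally show ?thesis by (simp only: L_add L_diff L_smult)
qed

text \<open>With \<open>f = P2 n\<close>, of degree \<open>n\<close>, only the term with
  \<open>e n\<close> survives.\<close>

lemma r2_sq: "1 / (T.r n)\<^sup>2 = e n / (r n)\<^sup>2"
  unfolding T.L_P_sq[symmetric] L_christoffel
  by (simp add: L_P_mult coeff_eq_0)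

lemma r2_sq': "1 / (T.r n)\<^sup>2 = cd_kernel p (n + 1) c c / cd_kernel p n c c / (r (n + 1))\<^sup>2"
  unfolding r2_sq e_coeff_eq by (simp add: power_divide)

text \<open>Source of the term with \<open>d (n - 1) / e (n - 1)\<close> in \<kappa>: orthogonality
  of \<open>P2 n\<close> and \<open>P2 (Suc n)\<close> determines the pairing of \<open>P n\<close>
  with the difference \<open>D\<close>, hence the top coefficient of \<open>D\<close>.\<close>

lemma coeff_P2: "coeff (P2 (Suc n)) n = coeff (P (Suc n)) n + d n / e n * \<gamma> (Suc n)"
proof -
  define D where "D = P2 (Suc n) - P (Suc n)"
  have D0: "coeff D k = 0" if "n < k" for k
    using that by (cases "k = Suc n") (auto simp: D_def coeff_eq_0)
  have 0: "L (P m * P2 (Suc n)) = 0" if "Suc n < m" for m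
    using that by (subst L_P_mult) (auto simp: coeff_eq_0)
  have 1: "L (P (Suc n) * P2 (Suc n)) = 1 / (r (Suc n))\<^sup>2"
    by (subst L_P_mult) (auto simp: coeff_eq_0)
  have "L (P2 n * P2 (Suc n) * [:- c, 1:]\<^sup>2) = 0"
    by (rule T.L_P_P) simp
  then have "e n * L (P n * P2 (Suc n)) = d n / (r (Suc n))\<^sup>2"
    unfolding L_christoffel using 0 1 by simp
  then have "L (P n * P2 (Suc n)) = d n / e n / (r (Suc n))\<^sup>2"
    using e_coeff_pos[of c n] by (simp add: field_simps)
  moreover have "L (P n * D) = L (P n * P2 (Suc n))"
    unfolding D_def right_diff_distrib L_diff by (simp add: L_P_P)
  moreover have "L (P n * D) = coeff D n / (r n)\<^sup>2"
    using D0 by (rule L_P_mult)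
  ultimately have "coeff D n = d n / e n * \<gamma> (Suc n)"
    unfolding \<gamma>_Suc by (simp add: power_divide field_simps)
  then show ?thesis by (simp add: D_def)
qed

text \<open>The difference \<open>D\<close> of two monic polynomials has degree below
  \<open>n\<close>, or is zero, so \<open>x * D\<close> contributes just one coefficient, known from
  \<open>coeff_P2\<close>. For \<open>n = 0\<close> it vanishes, matching the convention.\<close>

lemma L_P_X_P2:
  "L (P n * ([:0, 1:] * P2 n))
     = (\<beta> n + (if n = 0 then 0 else \<gamma> n * (d (n - 1) / e (n - 1)))) / (r n)\<^sup>2"
proof -
  define D where "D = P2 n - P n"
  have "L (P n * ([:0, 1:] * P n)) = \<beta> n / (r n)\<^sup>2"
    unfolding L_P_X_P_eq by (auto simp: L_P_P L_P_sq prev_def split: nat.splits)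
  moreover have "L (P n * ([:0, 1:] * D)) = coeff ([:0, 1:] * D) n / (r n)\<^sup>2"
  proof (rule L_P_mult)
    fix k assume "n < k"
    then obtain m where "k = Suc m" "n \<le> m" by (cases k) auto
    then show "coeff ([:0, 1:] * D) k = 0"
      by (cases "m = n") (auto simp: D_def coeff_eq_0)
  qed
  moreover have "coeff ([:0, 1:] * D) n = (if n = 0 then 0 else \<gamma> n * (d (n - 1) / e (n - 1)))"
    by (cases n) (auto simp: D_def coeff_P2)
  moreover have "L (P n * ([:0, 1:] * P2 n)) = L (P n * ([:0, 1:] * P n)) + L (P n * ([:0, 1:] * D))"
    unfolding L_add[symmetric] distrib_left[symmetric] D_def by simp
  ultimately show ?thesis by (simp add: add_divide_distrib)
qed

text \<open>Taking \<open>f = x * P2 n\<close> in \<open>L_christoffel\<close> gives three known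
  pairings, which make up \<kappa>; the norm ratio \<open>r2_sq'\<close> converts the other
  coefficient.\<close>

lemma three_term_P2:
  "[:0, 1:] * P2 n = P2 (n + 1)
     + smult ((\<beta> n + (if n = 0 then 0 else \<gamma> n * (d (n - 1) / e (n - 1)))) * e n * (T.r n / r n)\<^sup>2
         - d n * (T.r n / r (n + 1))\<^sup>2) (P2 n)
     + smult ((T.r (n - 1) / r (n + 1))\<^sup>2 * (cd_kernel p (n + 1) c c / cd_kernel p n c c)) (prev P2 n)"
proof -
  have "L (P (n + 2) * ([:0, 1:] * P2 n)) = 0"
    by (subst L_P_mult) (auto simp: coeff_X_mult coeff_eq_0 split: nat.splits)
  moreover have "L (P (n + 1) * ([:0, 1:] * P2 n)) = 1 / (r (n + 1))\<^sup>2"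
    by (subst L_P_mult) (auto simp: coeff_X_mult coeff_eq_0 split: nat.splits)
  ultimately have "(T.r n)\<^sup>2 * L (P2 n * ([:0, 1:] * P2 n) * [:- c, 1:]\<^sup>2)
      = (\<beta> n + (if n = 0 then 0 else \<gamma> n * (d (n - 1) / e (n - 1)))) * e n * (T.r n / r n)\<^sup>2
         - d n * (T.r n / r (n + 1))\<^sup>2"
    unfolding L_christoffel L_P_X_P2 by (simp add: power_divide add_divide_distrib algebra_simps)
  moreover have "(T.r (n - 1) / T.r n)\<^sup>2
      = (T.r (n - 1) / r (n + 1))\<^sup>2 * (cd_kernel p (n + 1) c c / cd_kernel p n c c)"
    using r2_sq'[of n] cd_kernel_pos[of "n + 1" c] by (simp add: power_divide field_simps)
  ultimately show ?thesis
    using T.three_term[of n] by simp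
qed

end

section \<open>Integration of polynomials over the interval\<close>

lemma set_integrable_poly:
  fixes M :: "real measure"
  assumes "\<And>n. integrable M (\<lambda>x. x ^ n)" "E \<in> sets M"
  shows "set_integrable M E (poly f)"
  unfolding set_integrable_def poly_altdef using assms by (intro integrable_mult_indicator) auto

text \<open>A nonnegative integrand with zero integral vanishes almost everywhere on
  \<open>E\<close>, and so does every multiple of it.\<close>

lemma set_integral_poly_mult_eq_0:
  fixes M :: "real measure"
  assumes moments: "\<And>n. integrable M (\<lambda>x. x ^ n)" and E: "E \<in> sets M"
    and nonneg: "\<And>x. x \<in> E \<Longrightarrow> 0 \<le> poly f x"
    and zero: "(LINT x:E|M. poly f x) = 0"
  shows "(LINT x:E|M. poly (f * g) x) = 0"
proof -
  have "AE x in M. indicator E x *\<^sub>R poly f x = 0"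
  proof (subst integral_nonneg_eq_0_iff_AE[symmetric])
    show "integrable M (\<lambda>x. indicator E x *\<^sub>R poly f x)"
      using set_integrable_poly[OF moments E] by (simp add: set_integrable_def)
  qed (use nonneg zero in \<open>auto simp: set_lebesgue_integral_def indicator_def\<close>)
  then have "AE x in M. indicator E x *\<^sub>R poly (f * g) x = 0"
    by eventually_elim auto
  then show ?thesis
    unfolding set_lebesgue_integral_def by (rule integral_eq_zero_AE)
qed

theorem proposition1:
  fixes M :: "real measure" and E :: "real set" and c :: real
    and P p P2 p2 :: "nat \<Rightarrow> real poly"
    and \<beta> \<gamma> r r2 d e :: "nat \<Rightarrow> real"
    and K :: "nat \<Rightarrow> real \<Rightarrow> real \<Rightarrow> real"
  assumes borel: "sets M = sets borel"
    and interval: "is_interval E"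
    and supp_infinite: "infinite (measure_support M)"
    and supp_subset: "measure_support M \<subseteq> E"
    and moments: "\<And>n. integrable M (\<lambda>x. x ^ n)"
    and c: "c \<notin> E"
    and P: "monic_orthogonal (ip M E) P"
    and P_rec: "\<And>n. [:0, 1:] * P n = P (n + 1) + smult (\<beta> n) (P n) + smult (\<gamma> n) (prev P n)"
    and p: "orthonormal_seq (ip M E) p"
    and P2: "monic_orthogonal (ip2 M E c) P2"
    and p2: "orthonormal_seq (ip2 M E c) p2"
    and r: "r = (\<lambda>n. lead_coeff (p n))"
    and r2: "r2 = (\<lambda>n. lead_coeff (p2 n))"
    and K: "K = cd_kernel p"
    and d: "d = d_coeff P c"
    and e: "e = e_coeff P c"
  shows "(\<exists>\<kappa> \<tau> :: nat \<Rightarrow> real.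
           P2 0 = 1 \<and>
           (\<forall>n. [:0, 1:] * P2 n = P2 (n + 1) + smult (\<kappa> n) (P2 n) + smult (\<tau> n) (prev P2 n)) \<and>
           (\<forall>n. \<kappa> n = (\<beta> n + (if n = 0 then 0 else \<gamma> n * (d (n - 1) / e (n - 1)))) * e n * (r2 n / r n)^2
                        - d n * (r2 n / r (n + 1))^2) \<and>
           (\<forall>n\<ge>1. \<tau> n = (r2 (n - 1) / r (n + 1))^2 * (K (n + 1) c c / K n c c) \<and> \<tau> n > 0)) \<and>
         (\<forall>n. poly (p (n + 1)) c \<noteq> 0 \<and>
              d n = r (n + 1) / r (n + 2) * (poly (p (n + 2)) c / poly (p (n + 1)) c)
                    + r n / r (n + 1) * (poly (p n) c / poly (p (n + 1)) c) * (K (n + 1) c c / K n c c)) \<and>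
         (\<forall>n. e n = (r n / r (n + 1))^2 * (K (n + 1) c c / K n c c) \<and> e n > 0)"
proof -
  have E: "E \<in> sets M"
    using interval borel by (simp add: real_interval_borel_measurable)
  \<comment> \<open>Both inner products depend only on the product of their arguments, so they come
    from this one functional, the second after multiplication by
    \<open>[:- c, 1:]\<^sup>2\<close>.\<close>
  define L where "L f = (LINT x:E|M. poly f x)" for f
  have ip: "ip M E = (\<lambda>f g. L (f * g))"
    by (simp add: fun_eq_iff ip_def L_def)
  have ip2: "ip2 M E c = (\<lambda>f g. L (f * g * [:- c, 1:]\<^sup>2))"
    by (simp add: fun_eq_iff ip2_def L_def)
  have add: "L (f + g) = L f + L g" for f g
    using set_integrable_poly[OF moments E, of f] set_integrable_poly[OF moments E, of g]
    by (simp add: L_def)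
  have smult: "L (smult a f) = a * L f" for a f
    by (simp add: L_def)
  interpret double_christoffel L p P \<beta> \<gamma> c p2 P2
  proof unfold_locales
    show "L ((f + g) * [:- c, 1:]\<^sup>2) = L (f * [:- c, 1:]\<^sup>2) + L (g * [:- c, 1:]\<^sup>2)" for f g
      by (simp only: distrib_right add)
    show "L (smult a f * [:- c, 1:]\<^sup>2) = a * L (f * [:- c, 1:]\<^sup>2)" for a f
      by (simp only: mult_smult_left smult)
  qed (use add smult P P_rec p P2 p2 in \<open>simp_all only: ip ip2\<close>)
  have nonzero: "poly (p (n + 1)) c \<noteq> 0" for n
  proof
    assume "poly (p (n + 1)) c = 0"
    then obtain q where q: "p (n + 1) = [:- c, 1:] * q"
      unfolding poly_eq_0_iff_dvd dvd_def by blast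
    have "q \<noteq> 0"
      using q r_nonzero[of "n + 1"] by auto
    then have deg_q: "degree q = n"
      using degree_p[of "n + 1"] unfolding q by (subst (asm) degree_mult_eq) auto
    have "L (p (n + 1) * q) = 0"
      by (subst L_p_mult) (auto simp: coeff_eq_0 deg_q)
    moreover define f where "f = [:- c, 1:] * q\<^sup>2"
    ultimately have L0: "L f = 0"
      by (simp only: q power2_eq_square mult.assoc)
    have f: "poly f x = (x - c) * (poly q x)\<^sup>2" for x
      by (simp add: f_def algebra_simps)
    have null: "L (h * g) = 0" if "\<And>x. x \<in> E \<Longrightarrow> 0 \<le> poly h x" "L h = 0" for h g
      using that unfolding L_def by (rule set_integral_poly_mult_eq_0[OF moments E])
    \<comment> \<open>An interval that omits \<open>c\<close> lies on one side of it, so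
      \<open>f\<close> has constant sign on \<open>E\<close>.\<close>
    have "(\<forall>x\<in>E. c \<le> x) \<or> (\<forall>x\<in>E. x \<le> c)"
      using c interval unfolding is_interval_1 by (meson le_cases)
    then have "L (f * [:- c, 1:]) = 0"
    proof
      assume "\<forall>x\<in>E. c \<le> x"
      then show ?thesis
        using L0 by (intro null) (simp_all add: f)
    next
      assume "\<forall>x\<in>E. x \<le> c"
      then have "L (smult (- 1) f * smult (- 1) [:- c, 1:]) = 0"
        using L0 smult[of "- 1" f] by (intro null) (simp_all add: f mult_le_0_iff)
      then show ?thesis by simp
    qed
    moreover have "p (n + 1) * p (n + 1) = f * [:- c, 1:]"
      unfolding q f_def power2_eq_square by (simp only: mult_ac)
    ultimately have "L (p (n + 1) * p (n + 1)) = 0"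
      by (simp only:)
    then show False by (simp add: L_p_p)
  qed
  show ?thesis
    unfolding r r2 K d e
  proof (intro conjI exI allI impI)
    show "P2 0 = 1"
      by (rule T.P_0)
    \<comment> \<open>The recurrence instantiates the witnesses for \<kappa> and \<tau>, so their
      formulas become reflexive. At index \<open>0\<close> the witness for \<tau> is a junk value
      multiplied by \<open>prev P2 0 = 0\<close>.\<close>
    show "[:0, 1:] * P2 n = P2 (n + 1)
     + smult ((\<beta> n + (if n = 0 then 0 else \<gamma> n * (d_coeff P c (n - 1) / e_coeff P c (n - 1))))
           * e_coeff P c n * (T.r n / lead_coeff (p n))\<^sup>2
         - d_coeff P c n * (T.r n / lead_coeff (p (n + 1)))\<^sup>2) (P2 n)
     + smult ((T.r (n - 1) / lead_coeff (p (n + 1)))\<^sup>2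
         * (cd_kernel p (n + 1) c c / cd_kernel p n c c)) (prev P2 n)" for n
      by (rule three_term_P2)
  next
    fix n :: nat
    show "0 < (T.r (n - 1) / lead_coeff (p (n + 1)))\<^sup>2 * (cd_kernel p (n + 1) c c / cd_kernel p n c c)"
      using cd_kernel_pos[of n c] cd_kernel_pos[of "n + 1" c] by simp
  next
    fix n
    show "poly (p (n + 1)) c \<noteq> 0"
      by (rule nonzero)
    then show "d_coeff P c n = lead_coeff (p (n + 1)) / lead_coeff (p (n + 2))
          * (poly (p (n + 2)) c / poly (p (n + 1)) c)
        + lead_coeff (p n) / lead_coeff (p (n + 1)) * (poly (p n) c / poly (p (n + 1)) c)
          * (cd_kernel p (n + 1) c c / cd_kernel p n c c)"
      by (rule d_coeff_eq)
    show "e_coeff P c n = (lead_coeff (p n) / lead_coeff (p (n + 1)))\<^sup>2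
        * (cd_kernel p (n + 1) c c / cd_kernel p n c c)"
      by (rule e_coeff_eq)
    show "0 < e_coeff P c n"
      by (rule e_coeff_pos)
  qed (rule refl)+
qed

end
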